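(* Let $b_1,b_2>0$, $c_1\ge b_1$, $c_2\ge b_2$, let $D=[c_1,c_1+b_1]\times[c_2,c_2+b_2]$, and let the buyer's valuation $z$ be uniformly distributed on $D$. Then the optimal mechanism is pure bundling: a buyer with $z_1+z_2\ge c_1+c_2+p^*$ receives the allocation $(1,1)$ and pays $c_1+c_2+p^*$, and every other buyer receives $(0,0)$ and pays $0$, where $$p^*=\frac{\sqrt{(c_1+c_2)^2+6b_1b_2}-c_1-c_2}{3}.$$
   Context: A seller sells two items to one buyer with valuation $z=(z_1,z_2)\in D$. A (direct) mechanism is a pair of an allocation function $q:D\to[0,1]^2$ and a payment function $t:D\to\mathbb{R}_{\ge0}$. It is incentive compatible if $z\cdot q(z)-t(z)\ge z\cdot q(\hat z)-t(\hat z)$ for all $z,\hat z\in D$, and individually rational if $z\cdot q(z)-t(z)\ge0$ for all $z\in D$. A mechanism is optimal if it maximizes the expected revenue $\mathbb{E}[t(z)]$ among all incentive compatible and individually rational mechanisms. "The optimal mechanism is X" means that mechanism X is optimal. *)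

theory Defs
  imports "HOL-Probability.Probability"
begin

type_synonym valuation = "real \<times> real"
type_synonym allocation = "real \<times> real"

definition is_mechanism ::
    "valuation set \<Rightarrow> (valuation \<Rightarrow> allocation) \<Rightarrow> (valuation \<Rightarrow> real) \<Rightarrow> bool" where
  "is_mechanism D q t \<longleftrightarrow> (\<forall>z\<in>D. q z \<in> {0..1} \<times> {0..1} \<and> t z \<ge> 0)"

definition incentive_compatible ::
    "valuation set \<Rightarrow> (valuation \<Rightarrow> allocation) \<Rightarrow> (valuation \<Rightarrow> real) \<Rightarrow> bool" where
  "incentive_compatible D q t \<longleftrightarrow> (\<forall>z\<in>D. \<forall>z'\<in>D. z \<bullet> q z - t z \<ge> z \<bullet> q z' - t z')"

definition individually_rational ::
    "valuation set \<Rightarrow> (valuation \<Rightarrow> allocation) \<Rightarrow> (valuation \<Rightarrow> real) \<Rightarrow> bool" where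
  "individually_rational D q t \<longleftrightarrow> (\<forall>z\<in>D. z \<bullet> q z - t z \<ge> 0)"

definition feasible_mechanism ::
    "valuation set \<Rightarrow> (valuation \<Rightarrow> allocation) \<Rightarrow> (valuation \<Rightarrow> real) \<Rightarrow> bool" where
  "feasible_mechanism D q t \<longleftrightarrow>
     is_mechanism D q t \<and> incentive_compatible D q t \<and> individually_rational D q t"

text \<open>
  The underlying space is \<open>D\<close> itself, so values of \<open>t\<close> outside \<open>D\<close> play no role. Lebesgue rather
  than Borel measurable sets are used because no measurability is imposed on mechanisms: for a
  rectangle \<open>D\<close>, incentive compatibility forces \<open>t\<close> to agree almost everywhere with a Borel
  function (\<open>q z\<close> is a subgradient of the convex function \<open>\<lambda>z. z \<bullet> q z - t z\<close>), and hence to be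
  Lebesgue measurable, but not to be Borel. Individual rationality and \<open>t \<ge> 0\<close> make \<open>t\<close> bounded
  on \<open>D\<close>, so the expected revenue of a feasible mechanism is a genuine integral.
\<close>

definition uniform_prior :: "valuation set \<Rightarrow> valuation measure" where
  "uniform_prior D = uniform_measure (lebesgue_on D) D"

definition expected_revenue :: "valuation measure \<Rightarrow> (valuation \<Rightarrow> real) \<Rightarrow> real" where
  "expected_revenue M t = (LINT z|M. t z)"

definition optimal_mechanism ::
    "valuation measure \<Rightarrow> (valuation \<Rightarrow> allocation) \<Rightarrow> (valuation \<Rightarrow> real) \<Rightarrow> bool" where
  "optimal_mechanism M q t \<longleftrightarrow>
     feasible_mechanism (space M) q t \<and>
     (\<forall>q' t'. feasible_mechanism (space M) q' t' \<longrightarrow>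
        expected_revenue M t' \<le> expected_revenue M t)"

definition bundling_allocation :: "real \<Rightarrow> valuation \<Rightarrow> allocation" where
  "bundling_allocation P z = (if fst z + snd z \<ge> P then (1, 1) else (0, 0))"

definition bundling_payment :: "real \<Rightarrow> valuation \<Rightarrow> real" where
  "bundling_payment P z = (if fst z + snd z \<ge> P then P else 0)"

lemma space_uniform_prior [simp]: "space (uniform_prior D) = D"
  by (simp add: uniform_prior_def)

end

(*
  Replace the buyer's utility u by the loss F(z) = z1 + z2 - u(z), the payment plus the value of the
  unsold shares. Incentive compatibility makes F nondecreasing and 1-Lipschitz in each coordinate,
  with supergradient (1,1) - q, so that t = F - z1 (1 - q1) - z2 (1 - q2). Integrating by parts bounds
  the revenue by 3 * (integral of F over D) plus c1 and c2 times the integrals over the lower edges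
  minus c1 + b1 and c2 + b2 times those over the upper edges. On the no-sale triangle individual
  rationality gives F <= z1 + z2. On the rest of D the signed measure above has total mass zero,
  by the first-order condition 3 p^2 + 2 (c1 + c2) p = 2 b1 b2 for the bundle price, and its positive
  part can be transported upwards onto the upper edges, where F is larger; so this part contributes
  nothing positive. The resulting bound is the bundling revenue.
*)
theory Submission
  imports Defs
begin

section \<open>A transport inequality for monotone functions on a rectangle\<close>

locale monotone_box =
  fixes b1 b2 :: real and f :: "real \<Rightarrow> real \<Rightarrow> real"
  assumes pos: "0 < b1" "0 < b2"
    and cont: "continuous_on ({0..b1} \<times> {0..b2}) (\<lambda>(x, y). f x y)"
    and mono: "\<lbrakk>0 \<le> x; x \<le> x'; x' \<le> b1; 0 \<le> y; y \<le> y'; y' \<le> b2\<rbrakk> \<Longrightarrow> f x y \<le> f x' y'"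
begin

text \<open>The conditions are symmetric in the two coordinates, so every estimate towards the edge
  \<open>x = b1\<close> also gives one towards the edge \<open>y = b2\<close>.\<close>

lemma monotone_box_flip: "monotone_box b2 b1 (\<lambda>x y. f y x)"
proof
  have "continuous_on ({0..b2} \<times> {0..b1}) ((\<lambda>(x, y). f x y) \<circ> prod.swap)"
    by (rule continuous_on_compose)
      (auto intro!: continuous_intros continuous_on_swap continuous_on_subset[OF cont])
  then show "continuous_on ({0..b2} \<times> {0..b1}) (\<lambda>(x, y). f y x)"
    by (simp add: comp_def case_prod_unfold)
qed (use pos mono in auto)

section \<open>Integrability along lines and exchange of integrals\<close>

lemma continuous_on_row: "y \<in> {0..b2} \<Longrightarrow> {a..b} \<subseteq> {0..b1} \<Longrightarrow> continuous_on {a..b} (\<lambda>x. f x y)"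
  by (rule continuous_on_compose2[OF cont, of _ "\<lambda>x. (x, y)", simplified])
    (auto intro!: continuous_intros)

lemma continuous_on_column: "x \<in> {0..b1} \<Longrightarrow> {u..v} \<subseteq> {0..b2} \<Longrightarrow> continuous_on {u..v} (\<lambda>y. f x y)"
  by (rule continuous_on_compose2[OF cont, of _ "\<lambda>y. (x, y)", simplified])
    (auto intro!: continuous_intros)

lemma integrable_row: "y \<in> {0..b2} \<Longrightarrow> {a..b} \<subseteq> {0..b1} \<Longrightarrow> (\<lambda>x. f x y) integrable_on {a..b}"
  by (intro integrable_continuous_real continuous_on_row)

lemma integrable_column: "x \<in> {0..b1} \<Longrightarrow> {u..v} \<subseteq> {0..b2} \<Longrightarrow> (\<lambda>y. f x y) integrable_on {u..v}"
  by (intro integrable_continuous_real continuous_on_column)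

lemma integrable_rows:
  assumes "{a..b} \<subseteq> {0..b1}" "{u..v} \<subseteq> {0..b2}"
  shows "(\<lambda>y. integral {a..b} (\<lambda>x. f x y)) integrable_on {u..v}"
proof -
  interpret flip: monotone_box b2 b1 "\<lambda>x y. f y x"
    by (rule monotone_box_flip)
  have "continuous_on ({u..v} \<times> cbox a b) (\<lambda>(y, x). f x y)"
    using assms by (intro continuous_on_subset[OF flip.cont]) auto
  then show ?thesis
    by (metis integral_continuous_on_param cbox_interval integrable_continuous_real)
qed

lemma swap_integrals:
  assumes "{a..b} \<subseteq> {0..b1}" "{u..v} \<subseteq> {0..b2}"
  shows "integral {a..b} (\<lambda>x. integral {u..v} (\<lambda>y. f x y)) =
    integral {u..v} (\<lambda>y. integral {a..b} (\<lambda>x. f x y))"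
proof -
  have "continuous_on (cbox (a, u) (b, v)) (\<lambda>(x, y). f x y)"
    using assms by (intro continuous_on_subset[OF cont]) (auto simp: cbox_Pair_eq)
  then show ?thesis
    using integral_swap_continuous by (metis cbox_interval)
qed

section \<open>Moving mass upwards to the edges\<close>

lemma integral_rows_le:
  assumes "0 \<le> a" "a \<le> b" "b \<le> b1" "0 \<le> u" "v \<le> b2"
  shows "integral {u..v} (\<lambda>y. integral {a..b} (\<lambda>x. f x y)) \<le> (b - a) * integral {u..v} (f b1)"
proof -
  have "integral {a..b} (\<lambda>x. f x y) \<le> (b - a) * f b1 y" if "y \<in> {u..v}" for y
  proof -
    have "integral {a..b} (\<lambda>x. f x y) \<le> integral {a..b} (\<lambda>x. f b1 y)"
      using assms that by (intro integral_le integrable_row mono) auto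
    then show ?thesis using assms by simp
  qed
  then have "integral {u..v} (\<lambda>y. integral {a..b} (\<lambda>x. f x y)) \<le> integral {u..v} (\<lambda>y. (b - a) * f b1 y)"
    using assms pos by (intro integral_le integrable_rows integrable_on_mult_right integrable_column) auto
  then show ?thesis by simp
qed

text \<open>On the row at height \<open>y\<close>, the points with \<open>x \<le> p - y\<close> are
  estimated by \<open>le\<close>, which gives \<open>- (p - y)\<^sup>2 / 2\<close>. The rest of the
  row has length \<open>y\<close> and is moved right to the edge \<open>x = b1\<close>, hence the
  weight \<open>y\<close> there. Integrating over \<open>y\<close> turns the first part into
  \<open>- p ^ 3 / 6\<close>.\<close>

lemma integral_square_le:
  assumes "0 < p" "p \<le> b1" "p \<le> b2"
    and le: "\<And>x y. \<lbrakk>0 \<le> x; x \<le> b1; 0 \<le> y; y \<le> b2\<rbrakk> \<Longrightarrow> f x y \<le> x + y - p"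
  shows "integral {0..p} (\<lambda>y. integral {0..p} (\<lambda>x. f x y)) \<le>
    integral {0..p} (\<lambda>y. y * f b1 y) - p ^ 3 / 6"
proof -
  have row: "integral {0..p} (\<lambda>x. f x y) \<le> y * f b1 y - (p - y)\<^sup>2 / 2" if y: "y \<in> {0..p}" for y
  proof -
    have "((\<lambda>x. x + y - p) has_integral ((p - y)\<^sup>2 / 2 + (y - p) * (p - y)) - (0\<^sup>2 / 2 + (y - p) * 0)) {0..p - y}"
      by (rule fundamental_theorem_of_calculus)
        (use y in \<open>auto intro!: derivative_eq_intros simp flip: has_real_derivative_iff_has_vector_derivative\<close>)
    then have "integral {0..p - y} (\<lambda>x. x + y - p) = - ((p - y)\<^sup>2 / 2)"
      by (simp add: integral_unique power2_eq_square algebra_simps)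
    moreover have "integral {0..p - y} (\<lambda>x. f x y) \<le> integral {0..p - y} (\<lambda>x. x + y - p)"
      using assms y by (intro integral_le integrable_row le integrable_continuous_real continuous_intros) auto
    moreover have "integral {p - y..p} (\<lambda>x. f x y) \<le> integral {p - y..p} (\<lambda>x. f b1 y)"
      using assms y by (intro integral_le integrable_row mono) auto
    moreover have "integral {0..p - y} (\<lambda>x. f x y) + integral {p - y..p} (\<lambda>x. f x y) = integral {0..p} (\<lambda>x. f x y)"
      using assms y by (intro Henstock_Kurzweil_Integration.integral_combine integrable_row) auto
    ultimately show ?thesis using y by simp
  qed
  have ftc: "((\<lambda>y. (p - y)\<^sup>2 / 2) has_integral - ((p - p) ^ 3 / 6) - - ((p - 0) ^ 3 / 6)) {0..p}"
    by (rule fundamental_theorem_of_calculus)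
      (use assms in \<open>auto intro!: derivative_eq_intros simp: power2_eq_square field_simps
        simp flip: has_real_derivative_iff_has_vector_derivative\<close>)
  have cube: "integral {0..p} (\<lambda>y. (p - y)\<^sup>2 / 2) = p ^ 3 / 6"
    by (rule integral_unique[OF has_integral_eq_rhs[OF ftc]]) simp
  have int: "(\<lambda>y. y * f b1 y) integrable_on {0..p}" "(\<lambda>y. (p - y)\<^sup>2 / 2) integrable_on {0..p}"
    using assms pos by (auto intro!: integrable_continuous_real continuous_intros continuous_on_column)
  have "integral {0..p} (\<lambda>y. integral {0..p} (\<lambda>x. f x y)) \<le>
      integral {0..p} (\<lambda>y. y * f b1 y - (p - y)\<^sup>2 / 2)"
    using assms row by (intro integral_le integrable_rows integrable_diff int) auto
  then show ?thesis
    unfolding Henstock_Kurzweil_Integration.integral_diff[OF int] cube .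
qed

text \<open>The density \<open>k - 3/2 * y\<close> is nonnegative on \<open>{0..p}\<close> and has
  total mass \<open>k * p - 3/4 * p\<^sup>2\<close>. Sliding all of it down to the corner
  \<open>(b1, 0)\<close> can only decrease the integral of a monotone function.\<close>

lemma weighted_edge_ge:
  assumes "0 < p" "p \<le> b2" "3/2 * p \<le> k"
  shows "k * integral {0..p} (f b1) - 3/2 * integral {0..p} (\<lambda>y. y * f b1 y) \<ge> (k * p - 3/4 * p\<^sup>2) * f b1 0"
proof -
  have ftc: "((\<lambda>y. (k - 3/2 * y) * f b1 0) has_integral
      (k * p - 3/4 * p\<^sup>2) * f b1 0 - (k * 0 - 3/4 * 0\<^sup>2) * f b1 0) {0..p}"
    by (rule fundamental_theorem_of_calculus)
      (use assms in \<open>auto intro!: derivative_eq_intros simp: algebra_simps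
        simp flip: has_real_derivative_iff_has_vector_derivative\<close>)
  have "(k * p - 3/4 * p\<^sup>2) * f b1 0 = integral {0..p} (\<lambda>y. (k - 3/2 * y) * f b1 0)"
    by (rule integral_unique[OF has_integral_eq_rhs[OF ftc], symmetric]) simp
  also have "\<dots> \<le> integral {0..p} (\<lambda>y. (k - 3/2 * y) * f b1 y)"
    using assms pos
    by (intro integral_le mult_left_mono mono integrable_continuous_real continuous_intros continuous_on_column) auto
  also have "\<dots> = integral {0..p} (\<lambda>y. k * f b1 y - 3/2 * (y * f b1 y))"
    by (intro Henstock_Kurzweil_Integration.integral_cong) (simp add: left_diff_distrib)
  also have "\<dots> = k * integral {0..p} (f b1) - 3/2 * integral {0..p} (\<lambda>y. y * f b1 y)"
    using assms pos
    by (subst Henstock_Kurzweil_Integration.integral_diff;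
        (intro integrable_continuous_real continuous_intros continuous_on_column)?) auto
  finally show ?thesis .
qed

text \<open>These are the two ways to move mass off the edge \<open>x = 0\<close>: across to the
  opposite edge, or up to the corner \<open>(0, b2)\<close>.\<close>

lemma low_edge_le:
  assumes "0 \<le> u" "u \<le> v" "v \<le> b2"
  shows "integral {u..v} (f 0) \<le> integral {u..v} (f b1)"
    and "integral {u..v} (f 0) \<le> (v - u) * f 0 b2"
proof -
  show "integral {u..v} (f 0) \<le> integral {u..v} (f b1)"
    using assms pos by (intro integral_le integrable_column mono) auto
  have "integral {u..v} (f 0) \<le> integral {u..v} (\<lambda>_. f 0 b2)"
    using assms pos by (intro integral_le integrable_column mono) auto
  then show "integral {u..v} (f 0) \<le> (v - u) * f 0 b2" using assms by simp
qed

lemma corner_edge_le: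
  assumes "0 < p" "p \<le> b2"
    and le: "\<And>x y. \<lbrakk>0 \<le> x; x \<le> b1; 0 \<le> y; y \<le> b2\<rbrakk> \<Longrightarrow> f x y \<le> x + y - p"
  shows "integral {0..p} (f 0) \<le> - (p\<^sup>2 / 2)"
proof -
  have "((\<lambda>y. y - p) has_integral (p\<^sup>2 / 2 - p * p) - (0\<^sup>2 / 2 - p * 0)) {0..p}"
    by (rule fundamental_theorem_of_calculus)
      (use assms in \<open>auto intro!: derivative_eq_intros simp flip: has_real_derivative_iff_has_vector_derivative\<close>)
  then have "integral {0..p} (\<lambda>y. y - p) = - (p\<^sup>2 / 2)"
    by (simp add: integral_unique power2_eq_square)
  moreover have "integral {0..p} (f 0) \<le> integral {0..p} (\<lambda>y. y - p)"
    using assms pos le[of 0] by (intro integral_le integrable_column integrable_continuous_real continuous_intros) auto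
  ultimately show ?thesis by simp
qed

lemma split_rows:
  assumes "0 \<le> p" "p \<le> b1" "p \<le> b2"
  shows "integral {0..b2} (\<lambda>y. integral {0..b1} (\<lambda>x. f x y)) =
    integral {0..p} (\<lambda>y. integral {0..p} (\<lambda>x. f x y)) + integral {0..p} (\<lambda>y. integral {p..b1} (\<lambda>x. f x y)) +
    (integral {p..b2} (\<lambda>y. integral {0..p} (\<lambda>x. f x y)) + integral {p..b2} (\<lambda>y. integral {p..b1} (\<lambda>x. f x y)))"
proof -
  have cut: "integral {u..v} (\<lambda>y. integral {0..b1} (\<lambda>x. f x y)) =
      integral {u..v} (\<lambda>y. integral {0..p} (\<lambda>x. f x y)) + integral {u..v} (\<lambda>y. integral {p..b1} (\<lambda>x. f x y))"
    if "{u..v} \<subseteq> {0..b2}" for u v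
  proof -
    have "integral {u..v} (\<lambda>y. integral {0..b1} (\<lambda>x. f x y)) =
        integral {u..v} (\<lambda>y. integral {0..p} (\<lambda>x. f x y) + integral {p..b1} (\<lambda>x. f x y))"
      using assms pos that
      by (intro Henstock_Kurzweil_Integration.integral_cong
          Henstock_Kurzweil_Integration.integral_combine[symmetric] integrable_row) auto
    then show ?thesis
      using assms that by (simp add: Henstock_Kurzweil_Integration.integral_add integrable_rows)
  qed
  have "integral {0..b2} (\<lambda>y. integral {0..b1} (\<lambda>x. f x y)) =
      integral {0..p} (\<lambda>y. integral {0..b1} (\<lambda>x. f x y)) + integral {p..b2} (\<lambda>y. integral {0..b1} (\<lambda>x. f x y))"
    using assms pos by (intro Henstock_Kurzweil_Integration.integral_combine[symmetric] integrable_rows) auto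
  then show ?thesis using assms cut[of 0 p] cut[of p b2] by simp
qed

text \<open>This is meant for the loss minus the bundle price \<open>c1 + c2 + p\<close>, for which
  \<open>le\<close> is individual rationality. The right-hand side is the contribution of the
  no-sale triangle when \<open>le\<close> is tight: \<open>- p ^ 3 / 2\<close> from its interior,
  \<open>- c1 * p\<^sup>2 / 2\<close> and \<open>- c2 * p\<^sup>2 / 2\<close> from its legs.\<close>

lemma transport_inequality:
  assumes c: "b1 \<le> c1" "b2 \<le> c2" and p: "0 < p" "p < b1" "p < b2"
    and price: "3 * p\<^sup>2 + 2 * (c1 + c2) * p = 2 * b1 * b2"
    and le: "\<And>x y. \<lbrakk>0 \<le> x; x \<le> b1; 0 \<le> y; y \<le> b2\<rbrakk> \<Longrightarrow> f x y \<le> x + y - p"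
  shows "3 * integral {0..b2} (\<lambda>y. integral {0..b1} (\<lambda>x. f x y))
      + c1 * integral {0..b2} (f 0) + c2 * integral {0..b1} (\<lambda>x. f x 0)
      - (c1 + b1) * integral {0..b2} (f b1) - (c2 + b2) * integral {0..b1} (\<lambda>x. f x b2)
    \<le> - ((c1 + c2 + p) * p\<^sup>2 / 2)"
proof -
  interpret flip: monotone_box b2 b1 "\<lambda>x y. f y x"
    by (rule monotone_box_flip)
  have le': "\<And>x y. \<lbrakk>0 \<le> x; x \<le> b2; 0 \<le> y; y \<le> b1\<rbrakk> \<Longrightarrow> f y x \<le> x + y - p"
    by (subst add.commute) (rule le)
  \<comment> \<open>The first index says whether \<open>x\<close> is below or above
    \<open>p\<close>, the second says the same for \<open>y\<close>. The letters \<open>r\<close>,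
    \<open>s\<close>, \<open>l\<close>, \<open>m\<close> stand for the right, upper, left and lower
    edge, with index 1 for the part up to \<open>p\<close>; \<open>rw\<close> and \<open>sw\<close>
    carry the weight from \<open>integral_square_le\<close>.\<close>
  define J11 where "J11 = integral {0..p} (\<lambda>y. integral {0..p} (\<lambda>x. f x y))"
  define J12 where "J12 = integral {p..b2} (\<lambda>y. integral {0..p} (\<lambda>x. f x y))"
  define J21 where "J21 = integral {0..p} (\<lambda>y. integral {p..b1} (\<lambda>x. f x y))"
  define J22 where "J22 = integral {p..b2} (\<lambda>y. integral {p..b1} (\<lambda>x. f x y))"
  define r1 r2 rw where "r1 = integral {0..p} (f b1)" and "r2 = integral {p..b2} (f b1)"
    and "rw = integral {0..p} (\<lambda>y. y * f b1 y)"
  define s1 s2 sw where "s1 = integral {0..p} (\<lambda>x. f x b2)" and "s2 = integral {p..b1} (\<lambda>x. f x b2)"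
    and "sw = integral {0..p} (\<lambda>x. x * f x b2)"
  define l1 l2 where "l1 = integral {0..p} (f 0)" and "l2 = integral {p..b2} (f 0)"
  define m1 m2 where "m1 = integral {0..p} (\<lambda>x. f x 0)" and "m2 = integral {p..b1} (\<lambda>x. f x 0)"
  \<comment> \<open>The edge \<open>x = b1\<close> has density \<open>c1 + b1\<close>. For
    \<open>y \<le> p\<close>, spending \<open>2 * (b1 - p)\<close> on \<open>J21\<close> and
    \<open>3/2 * y\<close> on half of the square leaves \<open>c1 - b1 + 2 * p - 3/2 * y\<close>,
    whose integral is \<open>M1\<close>. \<open>M2\<close> arises in the same way on
    \<open>y = b2\<close>.\<close>
  define M1 M2 where "M1 = (c1 - b1 + 2 * p) * p - 3/4 * p\<^sup>2" and "M2 = (c2 - b2 + 2 * p) * p - 3/4 * p\<^sup>2"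
  txt \<open>
    The upper edge \<open>y = b2\<close>, restricted to \<open>x \<le> p\<close>, retains the mass \<open>M2\<close> after dominating the points
    below it. This mass dominates a part of the lower edge \<open>x = 0\<close>; the mass of the edge \<open>x = b1\<close>
    that is freed thereby dominates the share \<open>k2\<close> of what is left on \<open>{p..b1} \<times> {p..b2}\<close>.
    Symmetrically for \<open>M1\<close> and \<open>k1\<close>; the shares add up to 1 by the equation for \<open>p\<close>.
  \<close>
  define k1 k2 where "k1 = M1 / ((b1 - p) * (b2 - p))" and "k2 = M2 / ((b1 - p) * (b2 - p))"
  have M: "M1 + M2 = (b1 - p) * (b2 - p)"
    using price unfolding M1_def M2_def by algebra
  \<comment> \<open>The assumptions \<open>c\<close> enter through signs: they make
    \<open>M1\<close> and \<open>M2\<close> nonnegative here, keep the weights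
    \<open>c1 - k2 * (b1 - p)\<close> and \<open>c2 - k1 * (b2 - p)\<close> nonnegative below, and
    give \<open>kp\<close>.\<close>
  have "p\<^sup>2 > 0" "(c1 - b1) * p \<ge> 0" "(c2 - b2) * p \<ge> 0" using p c by auto
  then have M0: "M1 \<ge> 0" "M2 \<ge> 0"
    unfolding M1_def M2_def power2_eq_square by (simp_all add: algebra_simps)
  have k: "k1 + k2 = 1" "k1 \<ge> 0" "k2 \<ge> 0"
    using M M0 p unfolding k1_def k2_def by (auto simp: add_divide_distrib[symmetric])
  have kM: "k1 * ((b1 - p) * (b2 - p)) = M1" "k2 * ((b1 - p) * (b2 - p)) = M2"
    using p unfolding k1_def k2_def by auto
  have kc1: "k2 * (b1 - p) \<le> c1" and kc2: "k1 * (b2 - p) \<le> c2"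
    using mult_left_le_one_le[of "b1 - p" k2] mult_left_le_one_le[of "b2 - p" k1] k p c by linarith+
  note p_le = less_imp_le[OF p(1)] less_imp_le[OF p(2)] less_imp_le[OF p(3)]
  have swap:
    "J11 = integral {0..p} (\<lambda>x. integral {0..p} (\<lambda>y. f x y))"
    "J12 = integral {0..p} (\<lambda>x. integral {p..b2} (\<lambda>y. f x y))"
    "J21 = integral {p..b1} (\<lambda>x. integral {0..p} (\<lambda>y. f x y))"
    "J22 = integral {p..b1} (\<lambda>x. integral {p..b2} (\<lambda>y. f x y))"
    unfolding J11_def J12_def J21_def J22_def using p_le by (intro swap_integrals[symmetric]; simp)+
  \<comment> \<open>Each block off the square is bounded twice: pushed right, and, through the
    flipped locale, pushed up.\<close>
  have J22: "J22 \<le> (b1 - p) * r2" "J22 \<le> (b2 - p) * s2"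
    unfolding r2_def s2_def using p_le integral_rows_le[of p b1 p b2] flip.integral_rows_le[of p b2 p b1]
    by (simp_all only: J22_def[symmetric] swap(4)[symmetric] order_refl)
  have J12: "J12 \<le> p * r2" "J12 \<le> (b2 - p) * s1"
    unfolding r2_def s1_def using p_le integral_rows_le[of 0 p p b2] flip.integral_rows_le[of p b2 0 p]
    by (simp_all only: J12_def[symmetric] swap(2)[symmetric] order_refl diff_zero)
  have J21: "J21 \<le> (b1 - p) * r1" "J21 \<le> p * s2"
    unfolding r1_def s2_def using p_le integral_rows_le[of p b1 0 p] flip.integral_rows_le[of 0 p p b1]
    by (simp_all only: J21_def[symmetric] swap(3)[symmetric] order_refl diff_zero)
  have J11: "J11 \<le> rw - p ^ 3 / 6" "J11 \<le> sw - p ^ 3 / 6"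
    unfolding rw_def sw_def
    using integral_square_le[OF p(1) p_le(2,3) le] flip.integral_square_le[OF p(1) p_le(3,2) le']
    by (simp_all only: J11_def[symmetric] swap(1)[symmetric])
  have kp: "3/2 * p \<le> c1 - b1 + 2 * p" "3/2 * p \<le> c2 - b2 + 2 * p"
    using p c by auto
  have w1: "(c1 - b1 + 2 * p) * r1 - 3/2 * rw \<ge> M1 * f b1 0"
    unfolding M1_def r1_def rw_def by (rule weighted_edge_ge[OF p(1) p_le(3) kp(1)])
  have w2: "(c2 - b2 + 2 * p) * s1 - 3/2 * sw \<ge> M2 * f 0 b2"
    unfolding M2_def s1_def sw_def by (rule flip.weighted_edge_ge[OF p(1) p_le(2) kp(2)])
  have l: "l1 \<le> - (p\<^sup>2 / 2)" "l2 \<le> r2" "l2 \<le> (b2 - p) * f 0 b2"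
    unfolding l1_def l2_def r2_def
    using corner_edge_le[OF p(1) p_le(3) le] low_edge_le[OF p_le(1,3) order_refl] by auto
  have m: "m1 \<le> - (p\<^sup>2 / 2)" "m2 \<le> s2" "m2 \<le> (b1 - p) * f b1 0"
    unfolding m1_def m2_def s2_def
    using flip.corner_edge_le[OF p(1) p_le(2) le'] flip.low_edge_le[OF p_le(1,2) order_refl] by auto
  \<comment> \<open>Each upper edge takes one copy of \<open>J22\<close>; the third copy is divided
    between them in the shares \<open>k2\<close> and \<open>k1\<close>.\<close>
  have "3 * J22 = (1 + k2) * J22 + (1 + k1) * J22"
    using k(1) by algebra
  also have "\<dots> \<le> (1 + k2) * ((b1 - p) * r2) + (1 + k1) * ((b2 - p) * s2)"
    using k by (intro add_mono mult_left_mono J22) auto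
  finally have e1: "3 * J22 \<le> (1 + k2) * ((b1 - p) * r2) + (1 + k1) * ((b2 - p) * s2)" .
  \<comment> \<open>Of the density \<open>c1\<close>, the part \<open>k2 * (b1 - p)\<close> goes up
    to the corner \<open>(0, b2)\<close>, where it amounts to the mass \<open>M2\<close> available
    there. The rest goes across to \<open>x = b1\<close>.\<close>
  have "c1 * l2 = (c1 - k2 * (b1 - p)) * l2 + k2 * (b1 - p) * l2"
    by algebra
  also have "\<dots> \<le> (c1 - k2 * (b1 - p)) * r2 + k2 * (b1 - p) * ((b2 - p) * f 0 b2)"
    using kc1 k p by (intro add_mono mult_left_mono l) auto
  also have "k2 * (b1 - p) * ((b2 - p) * f 0 b2) = M2 * f 0 b2"
    unfolding kM(2)[symmetric] by (simp only: mult.assoc)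
  finally have e2: "c1 * l2 \<le> (c1 - k2 * (b1 - p)) * r2 + M2 * f 0 b2" .
  have "c2 * m2 = (c2 - k1 * (b2 - p)) * m2 + k1 * (b2 - p) * m2"
    by algebra
  also have "\<dots> \<le> (c2 - k1 * (b2 - p)) * s2 + k1 * (b2 - p) * ((b1 - p) * f b1 0)"
    using kc2 k p by (intro add_mono mult_left_mono m) auto
  also have "k1 * (b2 - p) * ((b1 - p) * f b1 0) = M1 * f b1 0"
    unfolding kM(1)[symmetric] by (simp only: mult.assoc mult.left_commute[of "b2 - p"])
  finally have e3: "c2 * m2 \<le> (c2 - k1 * (b2 - p)) * s2 + M1 * f b1 0" .
  have e4: "c1 * l1 \<le> - (c1 * p\<^sup>2 / 2)" "c2 * m1 \<le> - (c2 * p\<^sup>2 / 2)"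
    using mult_left_mono[OF l(1), of c1] mult_left_mono[OF m(1), of c2] c pos by linarith+
  have sums: "integral {0..b2} (f b1) = r1 + r2" "integral {0..b1} (\<lambda>x. f x b2) = s1 + s2"
    "integral {0..b2} (f 0) = l1 + l2" "integral {0..b1} (\<lambda>x. f x 0) = m1 + m2"
    unfolding r1_def r2_def s1_def s2_def l1_def l2_def m1_def m2_def using p pos
    by (auto intro!: Henstock_Kurzweil_Integration.integral_combine[symmetric] integrable_row integrable_column)
  have J: "integral {0..b2} (\<lambda>y. integral {0..b1} (\<lambda>x. f x y)) = J11 + J21 + (J12 + J22)"
    unfolding J11_def J21_def J12_def J22_def using p by (intro split_rows) auto
  have "3 * (J11 + J21 + (J12 + J22)) + c1 * (l1 + l2) + c2 * (m1 + m2) =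
      3 * J11 + 3 * J21 + 3 * J12 + 3 * J22 + c1 * l2 + c2 * m2 + c1 * l1 + c2 * m1"
    by algebra
  \<comment> \<open>The three copies of the square are split evenly between the two edges.
    \<open>J21\<close> goes twice right and once up, \<open>J12\<close> once right and twice
    up.\<close>
  also have "\<dots> \<le> (3/2 * (rw - p ^ 3 / 6) + 3/2 * (sw - p ^ 3 / 6)) + (p * s2 + 2 * ((b1 - p) * r1)) +
      (p * r2 + 2 * ((b2 - p) * s1)) + ((1 + k2) * ((b1 - p) * r2) + (1 + k1) * ((b2 - p) * s2)) +
      ((c1 - k2 * (b1 - p)) * r2 + ((c2 - b2 + 2 * p) * s1 - 3/2 * sw)) +
      ((c2 - k1 * (b2 - p)) * s2 + ((c1 - b1 + 2 * p) * r1 - 3/2 * rw)) +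
      - (c1 * p\<^sup>2 / 2) + - (c2 * p\<^sup>2 / 2)"
  proof (intro add_mono order_trans[OF e2 add_left_mono[OF w2]] order_trans[OF e3 add_left_mono[OF w1]] e1 e4)
    show "3 * J11 \<le> 3/2 * (rw - p ^ 3 / 6) + 3/2 * (sw - p ^ 3 / 6)"
      using add_mono[OF J11] by (simp add: field_simps)
  qed (use J12 J21 in linarith)+
  \<comment> \<open>The balance is exact: \<open>rw\<close> and \<open>sw\<close> cancel, and the
    coefficients of \<open>r1\<close>, \<open>r2\<close>, \<open>s1\<close>, \<open>s2\<close> add
    up to the full edge densities.\<close>
  also have "\<dots> = (c1 + b1) * (r1 + r2) + (c2 + b2) * (s1 + s2) - (c1 + c2 + p) * p\<^sup>2 / 2"
    by algebra
  finally show ?thesis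
    unfolding sums J by linarith
qed

end

section \<open>Integration by parts with difference quotients\<close>

text \<open>A discrete form of integration by parts for \<open>(c + x) * g' x\<close>, as
  \<open>g\<close> need not be differentiable. Translating the integral of
  \<open>(c + x) * g (x + h)\<close> by \<open>h\<close> leaves boundary pieces on
  \<open>{0..h}\<close> and \<open>{b..b + h}\<close>, which after division by \<open>h\<close>
  become the boundary terms up to an error of order \<open>h\<close>.\<close>

lemma integral_weighted_difference_quotient_ge:
  fixes g :: "real \<Rightarrow> real"
  assumes params: "0 < b" "0 \<le> c" "0 < h" "h \<le> 1" "c \<le> K" "g b \<le> K"
    and cont: "continuous_on {0..} g" and mono: "\<And>x y. 0 \<le> x \<Longrightarrow> x \<le> y \<Longrightarrow> g x \<le> g y"
    and nonneg: "\<And>x. 0 \<le> x \<Longrightarrow> 0 \<le> g x" and const: "\<And>x. b \<le> x \<Longrightarrow> g x = g b"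
    and lip: "g h \<le> g 0 + h"
  shows "(c + b) * g b - c * g 0 - integral {0..b} g - h * (3 * K + 1) \<le>
    integral {0..b} (\<lambda>x. (c + x) * ((g (x + h) - g x) / h))"
proof -
  have int: "(\<lambda>x. (k + x) * g x) integrable_on {u..v}" "g integrable_on {u..v}" if "0 \<le> u" for u v k
    using that by (auto intro!: integrable_continuous_real continuous_intros continuous_on_subset[OF cont])
  have int_h: "(\<lambda>x. (c + x) * g (x + h)) integrable_on {0..b}"
    using params by (intro integrable_continuous_real continuous_intros continuous_on_compose2[OF cont]) auto
  note combine = Henstock_Kurzweil_Integration.integral_combine[symmetric]
  have split: "integral {0..b + h} \<phi> = integral {0..b} \<phi> + integral {b..b + h} \<phi>"
    "integral {0..b + h} \<phi> = integral {0..h} \<phi> + integral {h..b + h} \<phi>"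
    if "\<phi> integrable_on {0..b + h}" for \<phi> :: "real \<Rightarrow> real"
    using params that by (auto intro!: combine)
  have shift: "integral {0..b} (\<lambda>x. (c + x) * g (x + h)) =
      integral {h..b + h} (\<lambda>x. (c + x) * g x) - h * integral {h..b + h} g"
  proof -
    have "integral {0..b} (\<lambda>x. (c + x) * g (x + h)) = integral {0 + h..b + h} (\<lambda>x. (c + (x - h)) * g x)"
      by (subst integral_shift_Icc_real[symmetric]) (simp add: comp_def add.commute)
    also have "\<dots> = integral {h..b + h} (\<lambda>x. (c + x) * g x - h * g x)"
      by (simp add: algebra_simps)
    also have "\<dots> = integral {h..b + h} (\<lambda>x. (c + x) * g x) - h * integral {h..b + h} g"
      using params int by (subst Henstock_Kurzweil_Integration.integral_diff) auto
    finally show ?thesis .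
  qed
  have const_le: "g x \<le> g b" if "b \<le> x" for x
    using const[OF that] by simp
  have "integral {b..b + h} (\<lambda>x. (c + b) * g b) \<le> integral {b..b + h} (\<lambda>x. (c + x) * g x)"
    using params int by (intro integral_le mult_mono mono nonneg) auto
  moreover have "integral {0..h} (\<lambda>x. (c + x) * g x) \<le> integral {0..h} (\<lambda>x. (c + h) * g h)"
    using params int by (intro integral_le mult_mono mono nonneg) auto
  moreover have "integral {b..b + h} g \<le> integral {b..b + h} (\<lambda>x. g b)"
    using params int const_le by (intro integral_le) auto
  moreover have "0 \<le> integral {0..h} g"
    by (intro integral_nonneg int nonneg) auto
  ultimately have bounds:
    "h * ((c + b) * g b) \<le> integral {b..b + h} (\<lambda>x. (c + x) * g x)"
    "integral {0..h} (\<lambda>x. (c + x) * g x) \<le> h * ((c + h) * g h)"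
    "integral {b..b + h} g \<le> h * g b" "0 \<le> integral {0..h} g"
    using params by (simp_all add: mult.left_commute)
  have eqs:
    "integral {0..b} (\<lambda>x. (c + x) * g x) + integral {b..b + h} (\<lambda>x. (c + x) * g x) =
      integral {0..h} (\<lambda>x. (c + x) * g x) + integral {h..b + h} (\<lambda>x. (c + x) * g x)"
    "integral {0..b} g + integral {b..b + h} g = integral {0..h} g + integral {h..b + h} g"
    using split[of "\<lambda>x. (c + x) * g x"] split[of g] int[of 0] by simp_all
  have "h * integral {h..b + h} g \<le> h * (integral {0..b} g + h * g b)"
    using params bounds eqs by (intro mult_left_mono) auto
  then have "integral {0..b} (\<lambda>x. (c + x) * g (x + h)) - integral {0..b} (\<lambda>x. (c + x) * g x) \<ge>
      h * ((c + b) * g b) - h * ((c + h) * g h) - h * (integral {0..b} g + h * g b)"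
    using bounds eqs unfolding shift by linarith
  then have "((c + b) * g b - (c + h) * g h - integral {0..b} g - h * g b) \<le>
      (integral {0..b} (\<lambda>x. (c + x) * g (x + h)) - integral {0..b} (\<lambda>x. (c + x) * g x)) / h"
    using params by (simp add: field_simps)
  also have "\<dots> = integral {0..b} (\<lambda>x. ((c + x) * g (x + h) - (c + x) * g x) / h)"
    using params int int_h by (simp add: Henstock_Kurzweil_Integration.integral_diff)
  also have "\<dots> = integral {0..b} (\<lambda>x. (c + x) * ((g (x + h) - g x) / h))"
    by (simp add: algebra_simps diff_divide_distrib)
  finally have *: "(c + b) * g b - (c + h) * g h - integral {0..b} g - h * g b \<le>
    integral {0..b} (\<lambda>x. (c + x) * ((g (x + h) - g x) / h))" .
  \<comment> \<open>Replacing \<open>(c + h) * g h\<close> by \<open>c * g 0\<close> costs at most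
    \<open>h * (2 * K + 1)\<close>; the term \<open>h * g b\<close> left by the translation costs at
    most \<open>h * K\<close>.\<close>
  have "(c + h) * g h \<le> (c + h) * (g 0 + h)"
    using params lip by (intro mult_left_mono) auto
  also have "\<dots> = c * g 0 + h * (c + g 0 + h)"
    by (simp add: algebra_simps)
  also have "\<dots> \<le> c * g 0 + h * (2 * K + 1)"
    using params mono[of 0 b] by (intro add_mono mult_left_mono) auto
  finally have "(c + h) * g h + h * g b \<le> c * g 0 + h * (2 * K + 1) + h * K"
    using params by (intro add_mono mult_left_mono) auto
  then show ?thesis using * by (simp add: algebra_simps)
qed

text \<open>
  Coordinates are relative to the corner \<open>(c1, c2)\<close>, and \<open>f\<close> is extended constantly beyond the upper
  edges so that forward difference quotients make sense on the whole rectangle.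
\<close>

locale surplus_loss =
  fixes b1 b2 c1 c2 :: real and f :: "real \<Rightarrow> real \<Rightarrow> real"
  assumes positive: "0 < b1" "0 < b2" "0 \<le> c1" "0 \<le> c2"
    and cont_quadrant: "continuous_on ({0..} \<times> {0..}) (\<lambda>(x, y). f x y)"
    and mono_quadrant: "\<lbrakk>0 \<le> x; x \<le> x'; 0 \<le> y; y \<le> y'\<rbrakk> \<Longrightarrow> f x y \<le> f x' y'"
    and nonneg: "0 \<le> x \<Longrightarrow> 0 \<le> y \<Longrightarrow> 0 \<le> f x y"
    and upper: "0 \<le> x \<Longrightarrow> 0 \<le> y \<Longrightarrow> f x y \<le> c1 + c2 + x + y"
    and clamp: "f (min x b1) (min y b2) = f x y"
    and lip: "\<lbrakk>0 \<le> x; 0 \<le> y; 0 \<le> h\<rbrakk> \<Longrightarrow> f (x + h) y \<le> f x y + h"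
      "\<lbrakk>0 \<le> x; 0 \<le> y; 0 \<le> h\<rbrakk> \<Longrightarrow> f x (y + h) \<le> f x y + h"
begin

lemma surplus_loss_flip: "surplus_loss b2 b1 c2 c1 (\<lambda>x y. f y x)"
proof
  have "continuous_on ({0..} \<times> {0..}) ((\<lambda>(x, y). f x y) \<circ> prod.swap)"
    by (rule continuous_on_compose)
      (auto intro!: continuous_intros continuous_on_swap continuous_on_subset[OF cont_quadrant])
  then show "continuous_on ({0..} \<times> {0..}) (\<lambda>(x, y). f y x)"
    by (simp add: comp_def case_prod_unfold)
  show "f y x \<le> c2 + c1 + x + y" if "0 \<le> x" "0 \<le> y" for x y
    using upper[of y x] that by simp
qed (use positive mono_quadrant nonneg clamp lip in auto)

sublocale monotone_box b1 b2 f
  by unfold_locales (use positive mono_quadrant in \<open>auto intro: continuous_on_subset[OF cont_quadrant]\<close>)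

lemma continuous_on_f [continuous_intros]:
  assumes "continuous_on S u" "continuous_on S v" "\<And>z. z \<in> S \<Longrightarrow> 0 \<le> u z" "\<And>z. z \<in> S \<Longrightarrow> 0 \<le> v z"
  shows "continuous_on S (\<lambda>z. f (u z) (v z))"
  using continuous_on_compose2[OF cont_quadrant, of S "\<lambda>z. (u z, v z)"] assms by (auto intro: continuous_on_Pair)

text \<open>The payment written through the loss, with the supergradient replaced by forward
  difference quotients. Unlike the payment, it is continuous on the rectangle.\<close>

definition virtual_value :: "real \<Rightarrow> real \<times> real \<Rightarrow> real" where
  "virtual_value h = (\<lambda>(x, y). f x y - (c1 + x) * ((f (x + h) y - f x y) / h)
    - (c2 + y) * ((f x (y + h) - f x y) / h))"

lemma continuous_on_box:
  "h > 0 \<Longrightarrow> continuous_on (cbox (0, 0) (b1, b2)) (\<lambda>z. f (fst z) (snd z))"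
  "h > 0 \<Longrightarrow> continuous_on (cbox (0, 0) (b1, b2))
    (\<lambda>z. (c1 + fst z) * ((f (fst z + h) (snd z) - f (fst z) (snd z)) / h))"
  "h > 0 \<Longrightarrow> continuous_on (cbox (0, 0) (b1, b2))
    (\<lambda>z. (c2 + snd z) * ((f (fst z) (snd z + h) - f (fst z) (snd z)) / h))"
  by (auto intro!: continuous_intros simp: cbox_Pair_eq)

lemma continuous_on_virtual_value: "h > 0 \<Longrightarrow> continuous_on (cbox (0, 0) (b1, b2)) (virtual_value h)"
  using continuous_on_box[of h] unfolding virtual_value_def case_prod_unfold by (intro continuous_on_diff)

lemma integral_difference_quotient_ge:
  assumes h: "0 < h" "h \<le> 1" and K: "c1 + c2 + b1 + b2 \<le> K"
  shows "integral {0..b2} (\<lambda>y. integral {0..b1} (\<lambda>x. (c1 + x) * ((f (x + h) y - f x y) / h)))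
    \<ge> (c1 + b1) * integral {0..b2} (f b1) - c1 * integral {0..b2} (f 0)
      - integral {0..b2} (\<lambda>y. integral {0..b1} (\<lambda>x. f x y)) - h * (b2 * (3 * K + 1))"
proof -
  let ?L = "\<lambda>y. (c1 + b1) * f b1 y - c1 * f 0 y - integral {0..b1} (\<lambda>x. f x y) - h * (3 * K + 1)"
  let ?R = "\<lambda>y. integral {0..b1} (\<lambda>x. (c1 + x) * ((f (x + h) y - f x y) / h))"
  have le: "?L y \<le> ?R y" if "y \<in> {0..b2}" for y
  proof (rule integral_weighted_difference_quotient_ge)
    show "f b1 y \<le> K" using upper[of b1 y] that positive K by auto
    show "f x y = f b1 y" if "b1 \<le> x" for x
      using clamp[of x y] clamp[of b1 y] that by (simp add: min_absorb2)
    show "continuous_on {0..} (\<lambda>x. f x y)"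
      using that by (intro continuous_intros) auto
  qed (use positive h K that mono_quadrant nonneg lip(1)[of 0 y h] in auto)
  have "continuous_on ({0..b2} \<times> cbox 0 b1) (\<lambda>(y, x). (c1 + x) * ((f (x + h) y - f x y) / h))"
    unfolding case_prod_unfold using h by (intro continuous_intros) auto
  then have intR: "?R integrable_on {0..b2}"
    by (intro integrable_continuous_real integral_continuous_on_param[of "{0..b2}" 0 b1, unfolded cbox_interval])
      (simp only: cbox_interval)
  have ints: "f b1 integrable_on {0..b2}" "f 0 integrable_on {0..b2}"
      "(\<lambda>y. integral {0..b1} (\<lambda>x. f x y)) integrable_on {0..b2}"
    using pos by (auto intro!: integrable_rows integrable_column)
  have "(?L has_integral (c1 + b1) * integral {0..b2} (f b1) - c1 * integral {0..b2} (f 0)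
      - integral {0..b2} (\<lambda>y. integral {0..b1} (\<lambda>x. f x y)) - (b2 - 0) *\<^sub>R (h * (3 * K + 1))) {0..b2}"
    using pos has_integral_const_real[of "h * (3 * K + 1)" 0 b2]
    by (intro has_integral_diff has_integral_mult_right integrable_integral ints) simp
  from has_integral_le[OF this integrable_integral[OF intR] le] show ?thesis
    by (simp only: diff_zero real_scaleR_def mult.left_commute[of b2])
qed

text \<open>The coefficient 3 counts one double integral from \<open>f\<close> itself and one from
  integration by parts in each coordinate.\<close>

lemma integral_virtual_value_le:
  assumes h: "0 < h" "h \<le> 1" and K: "c1 + c2 + b1 + b2 \<le> K"
  shows "integral (cbox (0, 0) (b1, b2)) (virtual_value h) \<le>
    3 * integral {0..b2} (\<lambda>y. integral {0..b1} (\<lambda>x. f x y))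
      + c1 * integral {0..b2} (f 0) + c2 * integral {0..b1} (\<lambda>x. f x 0)
      - (c1 + b1) * integral {0..b2} (f b1) - (c2 + b2) * integral {0..b1} (\<lambda>x. f x b2)
      + h * ((b1 + b2) * (3 * K + 1))"
proof -
  interpret flip: surplus_loss b2 b1 c2 c1 "\<lambda>x y. f y x"
    by (rule surplus_loss_flip)
  let ?B = "cbox (0, 0) (b1, b2)"
  note cont = continuous_on_box[OF h(1)]
  note int = integrable_continuous[OF cont(1)] integrable_continuous[OF cont(2)] integrable_continuous[OF cont(3)]
  have "(virtual_value h has_integral (integral ?B (\<lambda>z. f (fst z) (snd z))
      - integral ?B (\<lambda>z. (c1 + fst z) * ((f (fst z + h) (snd z) - f (fst z) (snd z)) / h))
      - integral ?B (\<lambda>z. (c2 + snd z) * ((f (fst z) (snd z + h) - f (fst z) (snd z)) / h)))) ?B"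
    unfolding virtual_value_def case_prod_unfold
    by (intro has_integral_diff integrable_integral int)
  then have "integral ?B (virtual_value h) = integral ?B (\<lambda>z. f (fst z) (snd z))
      - integral ?B (\<lambda>z. (c1 + fst z) * ((f (fst z + h) (snd z) - f (fst z) (snd z)) / h))
      - integral ?B (\<lambda>z. (c2 + snd z) * ((f (fst z) (snd z + h) - f (fst z) (snd z)) / h))"
    by (rule integral_unique)
  moreover have "integral ?B (\<lambda>z. f (fst z) (snd z)) = integral {0..b1} (\<lambda>x. integral {0..b2} (\<lambda>y. f x y))"
    unfolding integral_prod_continuous[OF cont(1)] by (simp only: cbox_interval fst_conv snd_conv)
  moreover have "integral ?B (\<lambda>z. (c1 + fst z) * ((f (fst z + h) (snd z) - f (fst z) (snd z)) / h)) =
      integral {0..b2} (\<lambda>y. integral {0..b1} (\<lambda>x. (c1 + x) * ((f (x + h) y - f x y) / h)))"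
    unfolding integral_prod_continuous[OF cont(2)]
    using integral_swap_continuous[of 0 0 b1 b2 "\<lambda>x y. (c1 + x) * ((f (x + h) y - f x y) / h)"] cont(2)
    by (simp only: cbox_interval case_prod_unfold fst_conv snd_conv)
  moreover have "integral ?B (\<lambda>z. (c2 + snd z) * ((f (fst z) (snd z + h) - f (fst z) (snd z)) / h)) =
      integral {0..b1} (\<lambda>x. integral {0..b2} (\<lambda>y. (c2 + y) * ((f x (y + h) - f x y) / h)))"
    unfolding integral_prod_continuous[OF cont(3)] by (simp only: cbox_interval fst_conv snd_conv)
  moreover have "integral {0..b1} (\<lambda>x. integral {0..b2} (\<lambda>y. f x y)) =
      integral {0..b2} (\<lambda>y. integral {0..b1} (\<lambda>x. f x y))"
    by (intro swap_integrals) auto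
  moreover have "h * ((b1 + b2) * (3 * K + 1)) = h * (b1 * (3 * K + 1)) + h * (b2 * (3 * K + 1))"
    by algebra
  moreover have "c2 + c1 + b2 + b1 \<le> K"
    using K by simp
  ultimately show ?thesis
    using integral_difference_quotient_ge[OF h K] flip.integral_difference_quotient_ge[OF h, of K]
    by linarith
qed

text \<open>Subtracting the bundle price turns \<open>upper\<close> into the bound
  \<open>x + y - p\<close>. On constants the functional on the left is multiplication by
  \<open>b1 * b2\<close>, so undoing the shift adds \<open>P * b1 * b2\<close>.\<close>

lemma transport_bound:
  assumes c: "b1 \<le> c1" "b2 \<le> c2" and p: "0 < p" "p < b1" "p < b2"
    and price: "3 * p\<^sup>2 + 2 * (c1 + c2) * p = 2 * b1 * b2"
  shows "3 * integral {0..b2} (\<lambda>y. integral {0..b1} (\<lambda>x. f x y))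
      + c1 * integral {0..b2} (f 0) + c2 * integral {0..b1} (\<lambda>x. f x 0)
      - (c1 + b1) * integral {0..b2} (f b1) - (c2 + b2) * integral {0..b1} (\<lambda>x. f x b2)
    \<le> (c1 + c2 + p) * (b1 * b2 - p\<^sup>2 / 2)"
proof -
  define P where "P = c1 + c2 + p"
  interpret diff: monotone_box b1 b2 "\<lambda>x y. f x y - P"
    by unfold_locales (use pos mono in \<open>auto simp: case_prod_unfold intro!: continuous_intros\<close>)
  note diff_const = Henstock_Kurzweil_Integration.integral_diff[OF _ integrable_const_ivl]
  have edges: "integral {0..b2} (\<lambda>y. f x y - P) = integral {0..b2} (f x) - P * b2" if "x \<in> {0..b1}" for x
    using pos by (simp add: diff_const[OF integrable_column[OF that order_refl]])
  have edges': "integral {0..b1} (\<lambda>x. f x y - P) = integral {0..b1} (\<lambda>x. f x y) - P * b1" if "y \<in> {0..b2}" for y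
    using pos by (simp add: diff_const[OF integrable_row[OF that order_refl]])
  have "integral {0..b2} (\<lambda>y. integral {0..b1} (\<lambda>x. f x y - P)) =
      integral {0..b2} (\<lambda>y. integral {0..b1} (\<lambda>x. f x y) - P * b1)"
    by (intro Henstock_Kurzweil_Integration.integral_cong edges')
  also have "\<dots> = integral {0..b2} (\<lambda>y. integral {0..b1} (\<lambda>x. f x y)) - P * b1 * b2"
    using pos by (simp add: diff_const[OF integrable_rows[OF order_refl order_refl]])
  finally have rows: "integral {0..b2} (\<lambda>y. integral {0..b1} (\<lambda>x. f x y - P)) =
      integral {0..b2} (\<lambda>y. integral {0..b1} (\<lambda>x. f x y)) - P * b1 * b2" .
  have "f x y - P \<le> x + y - p" if "0 \<le> x" "0 \<le> y" for x y
    using upper[OF that] by (simp add: P_def)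
  from diff.transport_inequality[OF c p price this] show ?thesis
    using pos unfolding P_def[symmetric] by (simp add: rows edges edges' algebra_simps)
qed

lemma le_optimal_value:
  assumes "b1 \<le> c1" "b2 \<le> c2" "0 < p" "p < b1" "p < b2"
    and "3 * p\<^sup>2 + 2 * (c1 + c2) * p = 2 * b1 * b2"
    and le: "\<And>h. \<lbrakk>0 < h; h \<le> 1\<rbrakk> \<Longrightarrow> I \<le> integral (cbox (0, 0) (b1, b2)) (virtual_value h)"
  shows "I \<le> (c1 + c2 + p) * (b1 * b2 - p\<^sup>2 / 2)"
proof (rule field_le_epsilon)
  fix e :: real assume e: "0 < e"
  \<comment> \<open>\<open>E\<close> is the factor of \<open>h\<close> in the error of
    \<open>integral_virtual_value_le\<close> for the smallest admissible \<open>K\<close>, so the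
    step \<open>h\<close> below makes this error at most \<open>e\<close>.\<close>
  define E where "E = (b1 + b2) * (3 * (c1 + c2 + b1 + b2) + 1)"
  have "E > 0" unfolding E_def using positive by (intro mult_pos_pos) auto
  define h where "h = min 1 (e / E)"
  have h: "0 < h" "h \<le> 1" and "h * E \<le> e"
    using e \<open>E > 0\<close> by (auto simp: h_def min_def field_simps)
  then show "I \<le> (c1 + c2 + p) * (b1 * b2 - p\<^sup>2 / 2) + e"
    using le[OF h] integral_virtual_value_le[OF h order_refl] transport_bound[OF assms(1-6)]
    unfolding E_def by linarith
qed

end

section \<open>Mechanisms\<close>

lemma expected_revenue_uniform_prior:
  assumes D: "D \<in> lmeasurable" "0 < measure lebesgue D" and t: "t \<in> borel_measurable (lebesgue_on D)"
  shows "expected_revenue (uniform_prior D) t = (LINT z|lebesgue_on D. t z) / measure lebesgue D"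
proof -
  have sets: "D \<in> sets lebesgue" using D by auto
  have "emeasure (lebesgue_on D) D = ennreal (measure lebesgue D)"
    using D sets by (simp add: emeasure_restrict_space emeasure_eq_measure2)
  then have "uniform_prior D = density (lebesgue_on D) (\<lambda>z. ennreal (indicator D z / measure lebesgue D))"
    using D by (simp add: uniform_prior_def uniform_measure_def divide_ennreal flip: ennreal_indicator)
  moreover have "(\<lambda>z. indicator D z / measure lebesgue D :: real) \<in> borel_measurable (lebesgue_on D)"
    using sets by (intro borel_measurable_divide borel_measurable_indicator) (auto simp: sets_restrict_space)
  ultimately have "expected_revenue (uniform_prior D) t =
      (LINT z|lebesgue_on D. (indicator D z / measure lebesgue D) *\<^sub>R t z)"
    using D t by (simp add: expected_revenue_def integral_density)
  also have "\<dots> = (LINT z|lebesgue_on D. t z / measure lebesgue D)"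
    by (intro Bochner_Integration.integral_cong) auto
  finally show ?thesis by simp
qed

section \<open>The loss of a feasible mechanism\<close>

locale feasible_on_rectangle =
  fixes b1 b2 c1 c2 :: real and q t D
  assumes positive: "0 < b1" "0 < b2" "0 \<le> c1" "0 \<le> c2"
    and D_eq: "D = {c1..c1 + b1} \<times> {c2..c2 + b2}"
    and feasible: "feasible_mechanism D q t"
begin

definition loss :: "real \<times> real \<Rightarrow> real" where
  "loss z = fst z + snd z - (z \<bullet> q z - t z)"

definition loss_ext :: "real \<Rightarrow> real \<Rightarrow> real" where
  "loss_ext x y = loss (c1 + min x b1, c2 + min y b2)"

lemma mechanism:
  assumes "z \<in> D"
  shows "0 \<le> fst (q z)" "fst (q z) \<le> 1" "0 \<le> snd (q z)" "snd (q z) \<le> 1" "0 \<le> t z"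
    and "z' \<in> D \<Longrightarrow> z' \<bullet> q z - t z \<le> z' \<bullet> q z' - t z'" "0 \<le> z \<bullet> q z - t z"
  using feasible assms
  unfolding feasible_mechanism_def is_mechanism_def incentive_compatible_def individually_rational_def
  by (auto simp: mem_Times_iff)

text \<open>This is incentive compatibility of the type \<open>z'\<close> against the report
  \<open>z\<close>. The supergradient has components in \<open>{0..1}\<close>: their sign gives
  monotonicity, taking the supergradient at the larger point, and the bound 1 gives the Lipschitz
  estimate.\<close>

lemma loss_le_affine:
  assumes "z \<in> D" "z' \<in> D"
  shows "loss z' \<le> loss z + (fst z' - fst z) * (1 - fst (q z)) + (snd z' - snd z) * (1 - snd (q z))"
  using mechanism(6)[OF assms] by (simp add: loss_def inner_prod_def algebra_simps)

lemma payment_eq: "t z = loss z - fst z * (1 - fst (q z)) - snd z * (1 - snd (q z))"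
  by (simp add: loss_def inner_prod_def algebra_simps)

lemma loss_nonneg:
  assumes "z \<in> D"
  shows "0 \<le> loss z"
proof -
  have "0 \<le> fst z * (1 - fst (q z))" "0 \<le> snd z * (1 - snd (q z))"
    using assms positive mechanism[OF assms] by (auto simp: D_eq mem_Times_iff intro!: mult_nonneg_nonneg)
  then show ?thesis
    using payment_eq[of z] mechanism(5)[OF assms] by linarith
qed

lemma loss_mono:
  assumes "z \<in> D" "z' \<in> D" "fst z \<le> fst z'" "snd z \<le> snd z'"
  shows "loss z \<le> loss z'"
proof -
  have "(fst z - fst z') * (1 - fst (q z')) \<le> 0" "(snd z - snd z') * (1 - snd (q z')) \<le> 0"
    using assms mechanism[of z'] by (auto intro: mult_nonpos_nonneg)
  then show ?thesis using loss_le_affine[of z' z] assms by linarith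
qed

lemma loss_lipschitz:
  assumes "z \<in> D" "z' \<in> D"
  shows "loss z' \<le> loss z + \<bar>fst z' - fst z\<bar> + \<bar>snd z' - snd z\<bar>"
proof -
  have le_abs: "d * (1 - a) \<le> \<bar>d\<bar>" if "0 \<le> a" "a \<le> 1" for a d :: real
  proof -
    have "d * (1 - a) \<le> \<bar>d\<bar> * (1 - a)" using that by (intro mult_right_mono) auto
    also have "\<dots> \<le> \<bar>d\<bar>" using that by (intro mult_right_le_one_le) auto
    finally show ?thesis .
  qed
  show ?thesis
    using loss_le_affine[OF assms] le_abs[OF mechanism(1,2)[OF assms(1)], of "fst z' - fst z"]
      le_abs[OF mechanism(3,4)[OF assms(1)], of "snd z' - snd z"] by linarith
qed

lemma clamped_in_D: "0 \<le> x \<Longrightarrow> 0 \<le> y \<Longrightarrow> (c1 + min x b1, c2 + min y b2) \<in> D"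
  using positive by (auto simp: D_eq min_def)

lemma loss_ext_lipschitz:
  assumes "0 \<le> x" "0 \<le> y" "0 \<le> x'" "0 \<le> y'"
  shows "loss_ext x' y' \<le> loss_ext x y + \<bar>x' - x\<bar> + \<bar>y' - y\<bar>"
proof -
  have "\<bar>min x' b1 - min x b1\<bar> \<le> \<bar>x' - x\<bar>" "\<bar>min y' b2 - min y b2\<bar> \<le> \<bar>y' - y\<bar>"
    by auto
  then show ?thesis
    using loss_lipschitz[OF clamped_in_D clamped_in_D, OF assms] by (simp add: loss_ext_def)
qed

lemma continuous_on_loss_ext: "continuous_on ({0..} \<times> {0..}) (\<lambda>(x, y). loss_ext x y)"
proof -
  \<comment> \<open>The constant 2 comes from bounding each of the two coordinate differences by the
    Euclidean distance.\<close>
  have "2-lipschitz_on ({0..} \<times> {0..}) (\<lambda>(x, y). loss_ext x y)"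
  proof (rule lipschitz_onI)
    fix z z' :: "real \<times> real" assume z: "z \<in> {0..} \<times> {0..}" "z' \<in> {0..} \<times> {0..}"
    have "\<bar>fst z - fst z'\<bar> \<le> dist z z'" "\<bar>snd z - snd z'\<bar> \<le> dist z z'"
      using dist_fst_le[of z z'] dist_snd_le[of z z'] by (auto simp: dist_real_def)
    moreover have "loss_ext (fst z) (snd z) \<le> loss_ext (fst z') (snd z') + \<bar>fst z - fst z'\<bar> + \<bar>snd z - snd z'\<bar>"
      "loss_ext (fst z') (snd z') \<le> loss_ext (fst z) (snd z) + \<bar>fst z' - fst z\<bar> + \<bar>snd z' - snd z\<bar>"
      using z by (auto intro!: loss_ext_lipschitz simp: mem_Times_iff)
    ultimately show "dist (case z of (x, y) \<Rightarrow> loss_ext x y) (case z' of (x, y) \<Rightarrow> loss_ext x y) \<le> 2 * dist z z'"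
      unfolding dist_real_def case_prod_unfold by linarith
  qed simp
  then show ?thesis by (rule lipschitz_on_continuous_on)
qed

sublocale surplus_loss b1 b2 c1 c2 loss_ext
proof
  fix x y h :: real assume xy: "0 \<le> x" "0 \<le> y"
  note z = clamped_in_D[OF xy]
  show "0 \<le> loss_ext x y"
    unfolding loss_ext_def by (rule loss_nonneg[OF z])
  show "loss_ext x y \<le> c1 + c2 + x + y"
    using mechanism(7)[OF z] min.cobounded1[of x b1] min.cobounded1[of y b2]
    unfolding loss_ext_def loss_def fst_conv snd_conv by linarith
  assume h: "0 \<le> h"
  show "loss_ext (x + h) y \<le> loss_ext x y + h" "loss_ext x (y + h) \<le> loss_ext x y + h"
    using loss_ext_lipschitz[OF xy, of "x + h" y] loss_ext_lipschitz[OF xy, of x "y + h"] xy h by auto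
next
  fix x x' y y' :: real assume "0 \<le> x" "x \<le> x'" "0 \<le> y" "y \<le> y'"
  then show "loss_ext x y \<le> loss_ext x' y'"
    unfolding loss_ext_def by (intro loss_mono clamped_in_D) auto
qed (use positive continuous_on_loss_ext in \<open>auto simp: loss_ext_def\<close>)

text \<open>By \<open>loss_le_affine\<close> forward difference quotients are at most the
  supergradient components, and they enter \<open>virtual_value\<close> with a minus sign. Near the
  upper edges clamping shortens the step to some \<open>d \<le> h\<close>, which is harmless because
  these components are nonnegative.\<close>

lemma payment_le_virtual_value:
  assumes z: "z \<in> D" and h: "0 < h"
  shows "t z \<le> virtual_value h (z - (c1, c2))"
proof -
  obtain x y where xy: "z = (c1 + x, c2 + y)" "0 \<le> x" "x \<le> b1" "0 \<le> y" "y \<le> b2"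
    using z by (auto simp: D_eq intro!: that[of "fst z - c1" "snd z - c2"])
  have loss: "loss_ext x y = loss z"
    using xy by (simp add: loss_ext_def)
  have slope: "s * ((v - loss z) / h) \<le> s * a"
    if "v \<le> loss z + d * a" "0 \<le> s" "d \<le> h" "0 \<le> a" for v d s a :: real
  proof (intro mult_left_mono)
    have "d * a \<le> h * a" using that by (intro mult_right_mono) auto
    then show "(v - loss z) / h \<le> a" using that h by (simp add: field_simps)
  qed (use that in auto)
  have "(c1 + x) * ((loss_ext (x + h) y - loss z) / h) \<le> (c1 + x) * (1 - fst (q z))"
  proof (rule slope)
    show "loss_ext (x + h) y \<le> loss z + (min (x + h) b1 - x) * (1 - fst (q z))"
      using loss_le_affine[OF z clamped_in_D[of "x + h" y]] xy h by (simp add: loss_ext_def)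
  qed (use xy positive mechanism[OF z] in auto)
  moreover have "(c2 + y) * ((loss_ext x (y + h) - loss z) / h) \<le> (c2 + y) * (1 - snd (q z))"
  proof (rule slope)
    show "loss_ext x (y + h) \<le> loss z + (min (y + h) b2 - y) * (1 - snd (q z))"
      using loss_le_affine[OF z clamped_in_D[of x "y + h"]] xy h by (simp add: loss_ext_def)
  qed (use xy positive mechanism[OF z] in auto)
  ultimately show ?thesis
    using payment_eq[of z] xy(1) by (simp add: virtual_value_def loss)
qed

lemma D_cbox: "D = cbox (c1, c2) (c1 + b1, c2 + b2)"
  by (simp add: D_eq cbox_Pair_eq)

lemma payment_integral_le:
  assumes t: "integrable (lebesgue_on D) t" and h: "0 < h"
  shows "(LINT z|lebesgue_on D. t z) \<le> integral (cbox (0, 0) (b1, b2)) (virtual_value h)"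
proof -
  let ?G = "\<lambda>z. virtual_value h (z - (c1, c2))"
  have D: "D \<in> sets lebesgue" unfolding D_cbox by simp
  have "continuous_on D ?G"
    unfolding D_eq
    by (rule continuous_on_compose2[OF continuous_on_virtual_value[OF h]])
      (auto intro!: continuous_intros simp: cbox_Pair_eq)
  then have "?G integrable_on D"
    unfolding D_cbox by (rule integrable_continuous)
  then have "integral D t \<le> integral D ?G"
    using integrable_on_lebesgue_on[OF t D] payment_le_virtual_value[OF _ h] by (intro integral_le)
  also have "\<dots> = integral (cbox (0, 0) (b1, b2)) (virtual_value h)"
    using integral_shift_cbox_plus[of "(0, 0)" "(b1, b2)" ?G "(c1, c2)"]
    by (simp add: D_cbox comp_def add.commute)
  finally show ?thesis
    by (simp add: lebesgue_integral_eq_integral[OF t D])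
qed

end

section \<open>Feasibility and revenue of bundling\<close>

lemma feasible_bundling:
  assumes "0 \<le> P"
  shows "feasible_mechanism D (bundling_allocation P) (bundling_payment P)"
  using assms unfolding feasible_mechanism_def is_mechanism_def incentive_compatible_def individually_rational_def
  by (auto simp: bundling_allocation_def bundling_payment_def inner_prod_def)

text \<open>The triangle containing \<open>Z\<close> is the standard simplex, of area 1/2, scaled by
  \<open>p\<close> and translated to \<open>(c1, c2)\<close>.\<close>

lemma measure_unsold_le:
  assumes "0 < p" "Z \<in> sets lebesgue"
    and Z: "Z \<subseteq> {z. c1 \<le> fst z \<and> c2 \<le> snd z \<and> fst z + snd z \<le> c1 + c2 + p}"
  shows "measure lebesgue Z \<le> p\<^sup>2 / 2"
proof -
  let ?S = "convex hull (insert 0 Basis) :: (real \<times> real) set"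
  let ?A = "\<lambda>z. p *\<^sub>R z + (c1, c2) :: real \<times> real"
  have S: "z \<in> ?S \<longleftrightarrow> 0 \<le> fst z \<and> 0 \<le> snd z \<and> fst z + snd z \<le> 1" for z :: "real \<times> real"
    unfolding std_simplex by (cases z) (auto simp: Basis_prod_def sum.union_disjoint)
  have comp: "compact ?S"
    by (intro finite_imp_compact_convex_hull) simp
  then have "compact (?A ` ?S)"
    by (intro compact_continuous_image continuous_intros)
  then have "?A ` ?S \<in> lmeasurable" by (rule lmeasurable_compact)
  moreover have "Z \<subseteq> ?A ` ?S"
  proof
    fix z assume "z \<in> Z"
    then have "c1 \<le> fst z" "c2 \<le> snd z" "fst z + snd z \<le> c1 + c2 + p" using Z by auto
    then have "(1 / p) *\<^sub>R (z - (c1, c2)) \<in> ?S"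
      using assms(1) mult_left_mono[of "fst z + snd z" "c1 + c2 + p" p] by (simp add: S field_simps)
    moreover have "z = ?A ((1 / p) *\<^sub>R (z - (c1, c2)))"
      using assms(1) by simp
    ultimately show "z \<in> ?A ` ?S" by (rule rev_image_eqI)
  qed
  ultimately have "measure lebesgue Z \<le> measure lebesgue (?A ` ?S)"
    using assms(2) by (intro measure_mono_fmeasurable)
  also have "\<dots> = p\<^sup>2 * measure lebesgue ?S"
    using measure_lebesgue_affine[of p "(c1, c2)" ?S] by (simp add: add.commute power2_eq_square)
  also have "measure lebesgue ?S = measure lborel ?S"
    using comp by (intro measure_completion) (simp add: borel_compact)
  also have "\<dots> = 1 / 2"
    by (simp add: content_std_simplex)
  finally show ?thesis by simp
qed

text \<open>A lower bound suffices, since no feasible mechanism earns more than this value. It comes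
  from bounding the area of the no-sale region from above.\<close>

lemma bundling_revenue_ge:
  assumes D: "D = {c1..c1 + b1} \<times> {c2..c2 + b2}" and b: "0 < b1" "0 < b2" and p: "0 < p" and c: "0 \<le> c1 + c2 + p"
  shows "expected_revenue (uniform_prior D) (bundling_payment (c1 + c2 + p)) \<ge>
    (c1 + c2 + p) * (b1 * b2 - p\<^sup>2 / 2) / (b1 * b2)"
proof -
  let ?P = "c1 + c2 + p"
  define W where "W = D \<inter> {z. ?P \<le> fst z + snd z}"
  have cbox: "D = cbox (c1, c2) (c1 + b1, c2 + b2)"
    by (simp add: D cbox_Pair_eq)
  have meas: "D \<in> lmeasurable" unfolding cbox by simp
  have area: "measure lebesgue D = b1 * b2"
    using b unfolding cbox by (simp add: content_Pair)
  have "closed {z :: real \<times> real. ?P \<le> fst z + snd z}"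
    by (intro closed_Collect_le continuous_intros)
  then have W: "W \<in> lmeasurable"
    unfolding W_def by (intro fmeasurable_Int_fmeasurable meas) (simp add: borel_closed)
  have pay: "bundling_payment ?P z = ?P * indicator W z" if "z \<in> D" for z
    using that by (simp add: bundling_payment_def W_def)
  have Wsets: "W \<in> sets (lebesgue_on D)"
    using W meas by (auto simp: sets_restrict_space_iff W_def)
  have "bundling_payment ?P \<in> borel_measurable (lebesgue_on D)"
    using Wsets by (subst measurable_cong[OF pay]) (auto intro!: borel_measurable_times borel_measurable_indicator)
  then have "expected_revenue (uniform_prior D) (bundling_payment ?P) =
      (LINT z|lebesgue_on D. bundling_payment ?P z) / (b1 * b2)"
    using b meas by (simp add: expected_revenue_uniform_prior area)
  also have "(LINT z|lebesgue_on D. bundling_payment ?P z) = (LINT z|lebesgue_on D. ?P * indicator W z)"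
    by (intro Bochner_Integration.integral_cong pay) auto
  also have "\<dots> = ?P * measure lebesgue W"
    using Wsets meas by (simp add: measure_restrict_space W_def Int_ac)
  also have "measure lebesgue W = b1 * b2 - measure lebesgue (D - W)"
    using measurable_measure_Diff[OF meas _ , of W] W area by (simp add: W_def fmeasurableD)
  finally have "expected_revenue (uniform_prior D) (bundling_payment ?P) =
    ?P * (b1 * b2 - measure lebesgue (D - W)) / (b1 * b2)" .
  moreover have "measure lebesgue (D - W) \<le> p\<^sup>2 / 2"
    using p W meas by (intro measure_unsold_le[of p _ c1 c2]) (auto simp: W_def D)
  ultimately show ?thesis
    using b c by (auto intro!: divide_right_mono mult_left_mono)
qed

section \<open>Comparison of the two revenue bounds\<close>

theorem theorem8:
  fixes b1 b2 c1 c2 p :: real and D :: "(real \<times> real) set"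
  assumes "b1 > 0" and "b2 > 0" and "c1 \<ge> b1" and "c2 \<ge> b2"
    and "D = {c1..c1 + b1} \<times> {c2..c2 + b2}"
    and "p = (sqrt ((c1 + c2)^2 + 6 * b1 * b2) - c1 - c2) / 3"
  shows "optimal_mechanism (uniform_prior D)
           (bundling_allocation (c1 + c2 + p)) (bundling_payment (c1 + c2 + p))"
proof -
  note params = assms(1-4) and D = assms(5)
  let ?C = "c1 + c2"
  have "0 < b1 * b2" using params by simp
  have "3 * p + ?C = sqrt (?C\<^sup>2 + 6 * b1 * b2)" using assms(6) by simp
  then have "(3 * p + ?C)\<^sup>2 = ?C\<^sup>2 + 6 * b1 * b2" using params by simp
  \<comment> \<open>This is the vanishing of the derivative of
    \<open>(?C + p) * (b1 * b2 - p\<^sup>2 / 2)\<close> in \<open>p\<close>.\<close>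
  then have price: "3 * p\<^sup>2 + 2 * ?C * p = 2 * b1 * b2" by algebra
  have "sqrt (?C\<^sup>2) < sqrt (?C\<^sup>2 + 6 * b1 * b2)"
    using \<open>0 < b1 * b2\<close> by (intro real_sqrt_less_mono) simp
  then have p: "0 < p" using assms(6) params by simp
  \<comment> \<open>Since \<open>?C\<close> exceeds both \<open>b1\<close> and \<open>b2\<close>,
    this yields \<open>p < b2\<close> and \<open>p < b1\<close>, so the no-sale triangle fits into
    the rectangle.\<close>
  have "p * ?C < b1 * b2"
  proof -
    have "0 < p\<^sup>2" using p by simp
    moreover have "2 * ?C * p = 2 * (p * ?C)" "2 * b1 * b2 = 2 * (b1 * b2)" by simp_all
    ultimately show ?thesis using price by linarith
  qed
  moreover have "b1 * p < p * ?C" "b2 * p < p * ?C" using params p by auto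
  ultimately have "b1 * p < b1 * b2" "b2 * p < b2 * b1" by (simp_all add: mult.commute)
  then have "p < b2" "p < b1" using params by simp_all
  let ?R = "?C + p"
  have "expected_revenue (uniform_prior D) t \<le> ?R * (b1 * b2 - p\<^sup>2 / 2) / (b1 * b2)"
    if "feasible_mechanism D q t" for q t
  proof -
    interpret feasible_on_rectangle b1 b2 c1 c2 q t D
      using params D that by unfold_locales auto
    have meas: "D \<in> lmeasurable" unfolding D_cbox by simp
    have area: "measure lebesgue D = b1 * b2"
      using params unfolding D_cbox by (simp add: content_Pair)
    have "p\<^sup>2 < b1 * b2"
      using \<open>p < b1\<close> \<open>p < b2\<close> p by (simp add: power2_eq_square mult_strict_mono)
    then have "0 \<le> b1 * b2 - p\<^sup>2 / 2"
      using \<open>0 < b1 * b2\<close> by linarith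
    then have nonneg: "0 \<le> ?R * (b1 * b2 - p\<^sup>2 / 2)"
      using params p by (intro mult_nonneg_nonneg) auto
    \<comment> \<open>If \<open>t\<close> is not measurable or not integrable, its Bochner integral
      is 0 by convention, and the bound holds because it is nonnegative.\<close>
    show ?thesis
    proof (cases "t \<in> borel_measurable (lebesgue_on D)")
      case True
      have "(LINT z|lebesgue_on D. t z) \<le> ?R * (b1 * b2 - p\<^sup>2 / 2)"
      proof (cases "integrable (lebesgue_on D) t")
        case True
        then show ?thesis
          using params p \<open>p < b1\<close> \<open>p < b2\<close> price payment_integral_le by (intro le_optimal_value) auto
      qed (simp add: not_integrable_integral_eq nonneg)
      then show ?thesis
        using True meas \<open>0 < b1 * b2\<close>
        by (simp add: expected_revenue_uniform_prior area divide_right_mono)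
    next
      case False
      then have "\<not> integrable (uniform_prior D) t"
        using borel_measurable_integrable by (fastforce simp: uniform_prior_def uniform_measure_def)
      then show ?thesis
        using nonneg \<open>0 < b1 * b2\<close> by (simp add: expected_revenue_def not_integrable_integral_eq)
    qed
  qed
  moreover have "?R * (b1 * b2 - p\<^sup>2 / 2) / (b1 * b2) \<le> expected_revenue (uniform_prior D) (bundling_payment ?R)"
    using params p by (intro bundling_revenue_ge[OF D]) auto
  ultimately have "expected_revenue (uniform_prior D) t \<le> expected_revenue (uniform_prior D) (bundling_payment ?R)"
    if "feasible_mechanism D q t" for q t
    using that by (blast intro: order_trans)
  moreover have "feasible_mechanism D (bundling_allocation ?R) (bundling_payment ?R)"
    using params p by (intro feasible_bundling) simp
  ultimately show ?thesis
    unfolding optimal_mechanism_def space_uniform_prior by blast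
qed

end
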